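(* Let $S$ be a locally convex topological semilattice, and let $K$ be a locally compact closed convex subset of $S$. Then, for each compact subset $A$ of $K$ such that $K=\overline{\operatorname{co}}(A)$, we have $A\supset\operatorname{ex}K$.
   Context: A semilattice is a poset $S$ in which every nonempty finite subset $F$ has a supremum $\bigoplus F$; write $x\oplus y=\bigoplus\{x,y\}$. A subset $T\subset S$ is convex if it is a subsemilattice: $x\oplus y\in T$ for all $x,y\in T$ (the empty set is convex). The convex hull $\operatorname{co}(A)$ is the subsemilattice generated by $A$, and $\overline{\operatorname{co}}(A)$ is its topological closure. A point $x\in K$ is an extreme point of $K\subset S$ if $x\notin\operatorname{co}(K\setminus\{x\})$; $\operatorname{ex}K$ is the set of extreme points of $K$. A topological semilattice is a semilattice with a Hausdorff topology for which $\oplus:S\times S\to S$ is jointly continuous. It is locally convex if every point has a basis of (not necessarily open) convex neighbourhoods. *)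

theory Defs
  imports "HOL-Analysis.Analysis"
begin

text \<open>
  Semilattices are join semilattices: the binary join \<open>sup\<close> of \<^class>\<open>semilattice_sup\<close>
  plays the role of \<open>\<oplus>\<close>. Convexity below is semilattice convexity, unrelated to
  \<^const>\<open>convex\<close>.
\<close>

definition semilattice_convex :: "'a::semilattice_sup set \<Rightarrow> bool"
  where "semilattice_convex T \<longleftrightarrow> (\<forall>x\<in>T. \<forall>y\<in>T. sup x y \<in> T)"

text \<open>The empty set is convex, so \<open>semilattice_co {} = {}\<close>.\<close>

definition semilattice_co :: "'a::semilattice_sup set \<Rightarrow> 'a set"
  where "semilattice_co A = semilattice_convex hull A"

definition semilattice_extreme_points :: "'a::semilattice_sup set \<Rightarrow> 'a set"
  where "semilattice_extreme_points K = {x \<in> K. x \<notin> semilattice_co (K - {x})}"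

text \<open>
  The Hausdorff axiom is supplied by \<^class>\<open>t2_space\<close>; the order and the topology are
  otherwise related only by joint continuity of the join.
\<close>

definition topological_semilattice :: "'a::{semilattice_sup,t2_space} itself \<Rightarrow> bool"
  where "topological_semilattice _ \<longleftrightarrow>
    continuous_on (UNIV :: ('a \<times> 'a) set) (\<lambda>(x, y). sup x y)"

text \<open>The convex neighbourhoods need not be open, hence the use of \<^const>\<open>interior\<close>.\<close>

definition locally_convex_semilattice :: "'a::{semilattice_sup,t2_space} itself \<Rightarrow> bool"
  where "locally_convex_semilattice _ \<longleftrightarrow>
    (\<forall>(x::'a) U. open U \<longrightarrow> x \<in> U \<longrightarrow>
      (\<exists>C. semilattice_convex C \<and> x \<in> interior C \<and> C \<subseteq> U))"

end

theory Submission
  imports Defs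
begin

text \<open>
  This is the semilattice form of Milman's converse to the Krein--Milman theorem. Suppose that
  \<open>x \<in> K\<close> does not lie in \<open>A\<close>. Every point of \<open>A\<close> then has a neighbourhood in \<open>K\<close> whose closure
  is compact, convex and avoids \<open>x\<close> (\<open>compact_convex_neighbourhood_avoiding\<close>); finitely many of
  these closures cover \<open>A\<close>. The convex hull of their union is again compact
  (\<open>compact_semilattice_co_Union\<close>), hence closed, so it contains \<open>K = closure (semilattice_co A)\<close>
  and in particular \<open>x\<close>. Thus \<open>x\<close> lies in the convex hull of a union of subsets of \<open>K - {x}\<close>, so
  it is not an extreme point of \<open>K\<close>.

  The decisive point, and the difference from vector spaces, is that joins are idempotent: the
  convex hull of two convex sets \<open>C\<close> and \<open>D\<close> needs no coefficients, it consists of \<open>C\<close>, \<open>D\<close> and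
  the joins of a point of \<open>C\<close> with a point of \<open>D\<close>. It is therefore compact as soon as \<open>C\<close> and
  \<open>D\<close> are.
\<close>

lemma semilattice_convex_Inter:
  "(\<And>T. T \<in> \<T> \<Longrightarrow> semilattice_convex T) \<Longrightarrow> semilattice_convex (\<Inter>\<T>)"
  unfolding semilattice_convex_def by blast

lemma semilattice_convex_Int:
  "semilattice_convex S \<Longrightarrow> semilattice_convex T \<Longrightarrow> semilattice_convex (S \<inter> T)"
  unfolding semilattice_convex_def by blast

lemma semilattice_convex_co: "semilattice_convex (semilattice_co A)"
  unfolding semilattice_co_def by (rule hull_in) (simp add: semilattice_convex_Inter)

lemma subset_semilattice_co: "A \<subseteq> semilattice_co A"
  unfolding semilattice_co_def by (rule hull_subset)

lemma semilattice_co_mono: "A \<subseteq> B \<Longrightarrow> semilattice_co A \<subseteq> semilattice_co B"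
  unfolding semilattice_co_def by (rule hull_mono)

lemma semilattice_co_minimal:
  "A \<subseteq> T \<Longrightarrow> semilattice_convex T \<Longrightarrow> semilattice_co A \<subseteq> T"
  unfolding semilattice_co_def by (rule hull_minimal)

lemma semilattice_co_Un_co: "semilattice_co (A \<union> semilattice_co B) = semilattice_co (A \<union> B)"
  unfolding semilattice_co_def by (rule hull_Un_right[symmetric])

text \<open>
  Associativity, commutativity and idempotence sort any join of elements of \<open>C \<union> D\<close> into one
  join inside \<open>C\<close> and one inside \<open>D\<close>.
\<close>

lemma semilattice_co_Un_convex:
  fixes C D :: "'a::semilattice_sup set"
  assumes C: "semilattice_convex C" and D: "semilattice_convex D"
  shows "semilattice_co (C \<union> D) = C \<union> D \<union> (\<lambda>(c, d). sup c d) ` (C \<times> D)"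
    (is "_ = ?H")
proof
  let ?J = "(\<lambda>(c, d). sup c d) ` (C \<times> D)"
  have J: "sup c d \<in> ?J" if "c \<in> C" "d \<in> D" for c d
    using that by force
  have "sup u v \<in> ?H" if "u \<in> ?H" "v \<in> ?H" for u v
  proof -
    have CC: "sup a b \<in> C" if "a \<in> C" "b \<in> C" for a b
      using C that by (simp add: semilattice_convex_def)
    have DD: "sup a b \<in> D" if "a \<in> D" "b \<in> D" for a b
      using D that by (simp add: semilattice_convex_def)
    consider "u \<in> C" | "u \<in> D" | c d where "c \<in> C" "d \<in> D" "u = sup c d"
      using \<open>u \<in> ?H\<close> by auto
    note u_cases = this
    consider "v \<in> C" | "v \<in> D" | c d where "c \<in> C" "d \<in> D" "v = sup c d"
      using \<open>v \<in> ?H\<close> by auto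
    note v_cases = this
    show ?thesis
    proof (rule u_cases; rule v_cases)
      fix c d assume "u \<in> C" and v: "c \<in> C" "d \<in> D" "v = sup c d"
      then have "sup (sup u c) d \<in> ?J" by (intro J CC)
      then show ?thesis by (simp add: v(3) sup_assoc)
    next
      fix c d assume "u \<in> D" and v: "c \<in> C" "d \<in> D" "v = sup c d"
      then have "sup c (sup u d) \<in> ?J" by (intro J DD)
      then show ?thesis by (simp add: v(3) sup_left_commute)
    next
      fix c d assume u: "c \<in> C" "d \<in> D" "u = sup c d" and "v \<in> C"
      then have "sup (sup c v) d \<in> ?J" by (intro J CC)
      then show ?thesis by (simp add: u(3) ac_simps)
    next
      fix c d assume u: "c \<in> C" "d \<in> D" "u = sup c d" and "v \<in> D"
      then have "sup c (sup d v) \<in> ?J" by (intro J DD)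
      then show ?thesis by (simp add: u(3) ac_simps)
    next
      fix c d c' d' assume u: "c \<in> C" "d \<in> D" "u = sup c d"
        and v: "c' \<in> C" "d' \<in> D" "v = sup c' d'"
      then have "sup (sup c c') (sup d d') \<in> ?J" by (intro J CC DD)
      then show ?thesis by (simp add: u(3) v(3) ac_simps)
    next
      assume "u \<in> D" "v \<in> C"
      then have "sup v u \<in> ?J" by (intro J)
      then show ?thesis by (simp add: sup_commute)
    qed (blast intro: CC DD J)+
  qed
  then have "semilattice_convex ?H"
    unfolding semilattice_convex_def by blast
  then show "semilattice_co (C \<union> D) \<subseteq> ?H"
    by (intro semilattice_co_minimal) auto
  have "C \<subseteq> semilattice_co (C \<union> D)" "D \<subseteq> semilattice_co (C \<union> D)"
    using subset_semilattice_co[of "C \<union> D"] by auto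
  then show "?H \<subseteq> semilattice_co (C \<union> D)"
    using semilattice_convex_co[of "C \<union> D"] unfolding semilattice_convex_def by auto
qed

lemma semilattice_convex_closure:
  fixes T :: "'a::{semilattice_sup,t2_space} set"
  assumes S: "topological_semilattice TYPE('a)" and T: "semilattice_convex T"
  shows "semilattice_convex (closure T)"
proof -
  have "(\<lambda>(x, y). sup x y) ` closure (T \<times> T) \<subseteq> closure T"
  proof (rule image_closure_subset)
    show "continuous_on (closure (T \<times> T)) (\<lambda>(x, y). sup x y)"
      using S continuous_on_subset unfolding topological_semilattice_def by blast
    show "(\<lambda>(x, y). sup x y) ` (T \<times> T) \<subseteq> closure T"
      using T closure_subset[of T] unfolding semilattice_convex_def by auto
  qed simp
  then show ?thesis
    unfolding semilattice_convex_def closure_Times by auto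
qed

lemma compact_semilattice_co_Un:
  fixes C D :: "'a::{semilattice_sup,t2_space} set"
  assumes S: "topological_semilattice TYPE('a)"
    and C: "compact C" "semilattice_convex C" and D: "compact D" "semilattice_convex D"
  shows "compact (semilattice_co (C \<union> D))"
proof -
  have "continuous_on (C \<times> D) (\<lambda>(x, y). sup x y)"
    using S continuous_on_subset unfolding topological_semilattice_def by blast
  then have "compact ((\<lambda>(x, y). sup x y) ` (C \<times> D))"
    using C D by (intro compact_continuous_image compact_Times)
  then show ?thesis
    using C D by (simp add: semilattice_co_Un_convex compact_Un)
qed

text \<open>
  The members of the family must be convex: in the Hilbert cube with coordinatewise maxima, the
  unit vectors together with \<open>0\<close> form a compact set whose convex hull is not closed, since it
  omits the point with all coordinates equal to one.
\<close>

lemma compact_semilattice_co_Union: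
  fixes \<F> :: "'a::{semilattice_sup,t2_space} set set"
  assumes S: "topological_semilattice TYPE('a)" and "finite \<F>"
    and "\<And>C. C \<in> \<F> \<Longrightarrow> compact C \<and> semilattice_convex C"
  shows "compact (semilattice_co (\<Union>\<F>))"
  using assms(2,3)
proof (induction \<F> rule: finite_induct)
  case empty
  have "semilattice_co {} = ({} :: 'a set)"
    using semilattice_co_minimal[of "{}" "{}"] by (simp add: semilattice_convex_def)
  then show ?case by simp
next
  case (insert C \<F>)
  have "compact (semilattice_co (C \<union> semilattice_co (\<Union>\<F>)))"
    using insert S by (intro compact_semilattice_co_Un semilattice_convex_co) auto
  then show ?case
    by (simp add: semilattice_co_Un_co)
qed

text \<open>
  The ambient space is only Hausdorff, so a closed convex neighbourhood cannot be obtained from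
  regularity. Instead, a convex neighbourhood of \<open>a\<close> is chosen inside an open set that is disjoint
  from some neighbourhood of \<open>x\<close> and whose trace on \<open>K\<close> lies in a compact set: its own trace on
  \<open>K\<close> then has the required closure.
\<close>

lemma compact_convex_neighbourhood_avoiding:
  fixes K :: "'a::{semilattice_sup,t2_space} set"
  assumes S: "topological_semilattice TYPE('a)"
    and lc: "locally_convex_semilattice TYPE('a)"
    and K: "semilattice_convex K" "locally_compact_space (top_of_set K)"
    and a: "a \<in> K" "a \<noteq> x"
  obtains W C where "open W" "a \<in> W" "W \<inter> K \<subseteq> C" "compact C" "semilattice_convex C"
    "C \<subseteq> K - {x}"
proof -
  obtain U V where U: "openin (top_of_set K) U" "a \<in> U" "U \<subseteq> V"
    and V: "compactin (top_of_set K) V"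
    using K(2) a(1) unfolding locally_compact_space_def by force
  obtain O' where O': "open O'" "U = K \<inter> O'"
    using U(1) by (auto simp: openin_open)
  have V': "compact V" "V \<subseteq> K"
    using V by (auto simp: compactin_subtopology)
  obtain G H where GH: "open G" "open H" "a \<in> G" "x \<in> H" "G \<inter> H = {}"
    using hausdorff[OF a(2)] by blast
  obtain N where N: "semilattice_convex N" "a \<in> interior N" "N \<subseteq> O' \<inter> G"
    using lc O' GH U(2) unfolding locally_convex_semilattice_def
    by (metis IntD2 IntI open_Int)
  have "N \<inter> K \<subseteq> V - H"
    using N(3) O'(2) U(3) GH(5) by blast
  moreover have "closed (V - H)"
    using V'(1) GH(2) by (simp add: compact_imp_closed closed_Diff)
  ultimately have cl: "closure (N \<inter> K) \<subseteq> V - H"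
    by (rule closure_minimal)
  show ?thesis
  proof (rule that[of "interior N" "closure (N \<inter> K)"])
    show "interior N \<inter> K \<subseteq> closure (N \<inter> K)"
      using interior_subset[of N] closure_subset[of "N \<inter> K"] by blast
    show "compact (closure (N \<inter> K))"
      using cl V'(1) compact_Int_closed[of V "closure (N \<inter> K)"]
      by (metis Diff_subset closed_closure inf.absorb2 subset_trans)
    show "semilattice_convex (closure (N \<inter> K))"
      using S N(1) K(1) by (intro semilattice_convex_closure semilattice_convex_Int)
    show "closure (N \<inter> K) \<subseteq> K - {x}"
      using cl V'(2) GH(4) by blast
  qed (use N(2) in auto)
qed

theorem theorem5p15:
  fixes K A :: "'a::{semilattice_sup,t2_space} set"
  assumes "topological_semilattice TYPE('a)"
    and "locally_convex_semilattice TYPE('a)"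
    and "closed K"
    and "semilattice_convex K"
    and "locally_compact_space (top_of_set K)"
    and "compact A"
    and "A \<subseteq> K"
    and "K = closure (semilattice_co A)"
  shows "semilattice_extreme_points K \<subseteq> A"
proof
  fix x assume x: "x \<in> semilattice_extreme_points K"
  show "x \<in> A"
  proof (rule ccontr)
    assume "x \<notin> A"
    have "\<exists>W C. open W \<and> a \<in> W \<and> W \<inter> K \<subseteq> C \<and> compact C \<and> semilattice_convex C
        \<and> C \<subseteq> K - {x}" if "a \<in> A" for a
    proof -
      have "a \<in> K" "a \<noteq> x"
        using that \<open>x \<notin> A\<close> assms(7) by auto
      then show ?thesis
        using compact_convex_neighbourhood_avoiding[OF assms(1,2,4,5)] by metis
    qed
    then obtain W C where W: "\<And>a. a \<in> A \<Longrightarrow> open (W a)" "\<And>a. a \<in> A \<Longrightarrow> a \<in> W a"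
        "\<And>a. a \<in> A \<Longrightarrow> W a \<inter> K \<subseteq> C a"
      and C: "\<And>a. a \<in> A \<Longrightarrow> compact (C a) \<and> semilattice_convex (C a)"
        "\<And>a. a \<in> A \<Longrightarrow> C a \<subseteq> K - {x}"
      by metis
    obtain F where F: "F \<subseteq> A" "finite F" "A \<subseteq> (\<Union>a\<in>F. W a)"
      using compactE_image[OF assms(6), of A W] W(1,2) by blast
    let ?Q = "semilattice_co (\<Union>(C ` F))"
    have "A \<subseteq> \<Union>(C ` F)"
      using F(1,3) W(3) assms(7) by blast
    then have "semilattice_co A \<subseteq> ?Q"
      by (rule semilattice_co_mono)
    moreover have "compact ?Q"
      using F(1,2) C(1) by (intro compact_semilattice_co_Union[OF assms(1)]) auto
    ultimately have "K \<subseteq> ?Q"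
      using assms(8) by (simp add: closure_minimal compact_imp_closed)
    also have "?Q \<subseteq> semilattice_co (K - {x})"
      using F(1) C(2) by (intro semilattice_co_mono) blast
    finally show False
      using x unfolding semilattice_extreme_points_def by blast
  qed
qed

end
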